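(* Let $\mu/\alpha$ and $\nu/\beta$ be skew Young diagrams. Then $$f(\mu/\alpha\vee\nu/\beta)\cdot f(\mu/\alpha\wedge\nu/\beta)\ \ge\ f(\mu/\alpha)\cdot f(\nu/\beta),$$ where $\mu/\alpha\vee\nu/\beta:=(\mu\vee\nu)/(\alpha\vee\beta)$ and $\mu/\alpha\wedge\nu/\beta:=(\mu\wedge\nu)/(\alpha\wedge\beta)$.
   Context: A partition $\lambda=(\lambda_1\ge\lambda_2\ge\dots)$ is identified with its Young diagram $\{(i,j): 1\le j\le\lambda_i\}$. If $\tau\subseteq\lambda$ are Young diagrams, the skew Young diagram $\lambda/\tau$ is the set difference $\lambda\setminus\tau$. For Young diagrams, $\vee$ and $\wedge$ denote the union and the intersection of the diagrams (again Young diagrams). A standard Young tableau of shape $\lambda/\tau$ with $m=|\lambda/\tau|$ squares is a bijection $\lambda/\tau\to\{1,\dots,m\}$ that increases along rows (in $j$) and down columns (in $i$); $\mathrm{SYT}(\lambda/\tau)$ is the set of these, and $f(\lambda/\tau):=|\mathrm{SYT}(\lambda/\tau)|/m!$ (equal to $1$ for the empty shape). *)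

theory Defs
  imports Complex_Main "HOL-Library.FuncSet"
begin

text \<open>The parts of a partition are indexed from 1; the value at index 0 is irrelevant.\<close>

definition is_partition :: "(nat \<Rightarrow> nat) \<Rightarrow> bool" where
  "is_partition l \<longleftrightarrow> (\<forall>i\<ge>1. l (Suc i) \<le> l i) \<and> finite {i. i \<ge> 1 \<and> l i \<noteq> 0}"

definition diagram :: "(nat \<Rightarrow> nat) \<Rightarrow> (nat \<times> nat) set" where
  "diagram l = {(i, j). 1 \<le> i \<and> 1 \<le> j \<and> j \<le> l i}"

definition young_diagram :: "(nat \<times> nat) set \<Rightarrow> bool" where
  "young_diagram D \<longleftrightarrow> (\<exists>l. is_partition l \<and> D = diagram l)"

lemma finite_young_diagram:
  assumes "young_diagram D"
  shows "finite D"
proof -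
  obtain l where l: "is_partition l" "D = diagram l"
    using assms by (auto simp: young_diagram_def)
  have "D \<subseteq> (SIGMA i:{i. i \<ge> 1 \<and> l i \<noteq> 0}. {..l i})"
    unfolding l(2) diagram_def by auto
  then show ?thesis
    using l(1) unfolding is_partition_def by (elim finite_subset) (intro finite_SigmaI, auto)
qed

text \<open>Join and meet of Young diagrams are therefore simply union and intersection of sets.\<close>

lemma young_diagram_Un:
  assumes "young_diagram D" "young_diagram E"
  shows "young_diagram (D \<union> E)"
proof -
  obtain l m where l: "is_partition l" "D = diagram l" and m: "is_partition m" "E = diagram m"
    using assms by (auto simp: young_diagram_def)
  have "{i. i \<ge> 1 \<and> max (l i) (m i) \<noteq> 0} \<subseteq> {i. i \<ge> 1 \<and> l i \<noteq> 0} \<union> {i. i \<ge> 1 \<and> m i \<noteq> 0}"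
    by auto
  then have "finite {i. i \<ge> 1 \<and> max (l i) (m i) \<noteq> 0}"
    using l(1) m(1) unfolding is_partition_def by (elim finite_subset) (intro finite_UnI, auto)
  moreover have "max (l (Suc i)) (m (Suc i)) \<le> max (l i) (m i)" if "i \<ge> 1" for i
    using l(1) m(1) that by (meson is_partition_def max.mono)
  ultimately have "is_partition (\<lambda>i. max (l i) (m i))"
    by (simp add: is_partition_def)
  moreover have "D \<union> E = diagram (\<lambda>i. max (l i) (m i))"
    unfolding l(2) m(2) diagram_def by auto
  ultimately show ?thesis by (auto simp: young_diagram_def)
qed

lemma young_diagram_Int:
  assumes "young_diagram D" "young_diagram E"
  shows "young_diagram (D \<inter> E)"
proof -
  obtain l m where l: "is_partition l" "D = diagram l" and m: "is_partition m" "E = diagram m"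
    using assms by (auto simp: young_diagram_def)
  have "{i. i \<ge> 1 \<and> min (l i) (m i) \<noteq> 0} \<subseteq> {i. i \<ge> 1 \<and> l i \<noteq> 0}"
    by auto
  then have "finite {i. i \<ge> 1 \<and> min (l i) (m i) \<noteq> 0}"
    using l(1) unfolding is_partition_def by (elim finite_subset) auto
  moreover have "min (l (Suc i)) (m (Suc i)) \<le> min (l i) (m i)" if "i \<ge> 1" for i
    using l(1) m(1) that by (meson is_partition_def min.mono)
  ultimately have "is_partition (\<lambda>i. min (l i) (m i))"
    by (simp add: is_partition_def)
  moreover have "D \<inter> E = diagram (\<lambda>i. min (l i) (m i))"
    unfolding l(2) m(2) diagram_def by auto
  ultimately show ?thesis by (auto simp: young_diagram_def)
qed

text \<open>Tableaux are taken extensional, so that each one is counted once as a function on the shape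
  \<open>D\<close>. A skew shape \<open>\<lambda>/\<tau>\<close> is the set difference \<open>\<lambda> - \<tau>\<close>.\<close>

definition SYT :: "(nat \<times> nat) set \<Rightarrow> (nat \<times> nat \<Rightarrow> nat) set" where
  "SYT D = {T \<in> extensional D. bij_betw T D {1..card D}
     \<and> (\<forall>i j j'. (i, j) \<in> D \<longrightarrow> (i, j') \<in> D \<longrightarrow> j < j' \<longrightarrow> T (i, j) < T (i, j'))
     \<and> (\<forall>i i' j. (i, j) \<in> D \<longrightarrow> (i', j) \<in> D \<longrightarrow> i < i' \<longrightarrow> T (i, j) < T (i', j))}"

definition syt_ratio :: "(nat \<times> nat) set \<Rightarrow> real" where
  "syt_ratio D = real (card (SYT D)) / fact (card D)"

lemma syt_ratio_empty: "syt_ratio {} = 1"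
proof -
  have "SYT {} = {\<lambda>_. undefined}"
    by (auto simp: SYT_def bij_betw_def)
  then show ?thesis by (simp add: syt_ratio_def)
qed

end

theory Submission
  imports Defs "HOL-Library.Infinite_Set"
begin

text \<open>
  The inequality is the leading-coefficient shadow of an inequality between order polynomials.
  Order the cells by ``to the left in the same row or above in the same column''. For a finite
  skew shape \<open>D\<close> with \<open>n\<close> cells, the number \<open>\<Omega>(D, t)\<close> of weakly increasing maps
  \<open>D \<rightarrow> {1..t}\<close> grows like \<open>f(D) t\<^sup>n\<close>: the injective ones number \<open>t choose n\<close> times the number
  of standard tableaux, and only \<open>O(t\<^sup>n\<^sup>-\<^sup>1)\<close> maps are not injective
  (\<open>tendsto_order_maps_over_power\<close>). The shapes \<open>\<mu>/\<alpha> \<or> \<nu>/\<beta>\<close> and \<open>\<mu>/\<alpha> \<and> \<nu>/\<beta>\<close> together have as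
  many cells as \<open>\<mu>/\<alpha>\<close> and \<open>\<nu>/\<beta>\<close> do, so it suffices to compare \<open>\<Omega>\<close> at every \<open>t\<close>
  (\<open>card_order_maps_join_meet\<close>).

  For that comparison, extend a weakly increasing map on \<open>\<mu>/\<alpha>\<close> by \<open>0\<close> on \<open>\<alpha>\<close> and by \<open>t + 1\<close>
  outside \<open>\<mu>\<close>. Since \<open>\<alpha>\<close> and \<open>\<mu>\<close> are down-closed, the extension is still weakly increasing, and
  it remembers both \<open>\<alpha>\<close> and \<open>\<mu>\<close>. The pointwise minimum of an extended map for \<open>\<mu>/\<alpha>\<close> and one for
  \<open>\<nu>/\<beta>\<close> is an extended map for the join of the two shapes, and the pointwise maximum is one for
  the meet. Minimum and maximum become union and intersection of the regions above the graphs, so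
  the comparison is an instance of the Ahlswede--Daykin inequality
  \<open>|A| |B| \<le> |A \<or> B| |A \<and> B|\<close> for families of finite sets (\<open>card_join_meet_families\<close>), which
  follows from the four functions theorem.

  Nothing here is particular to Young diagrams: \<open>linear_exts_join_meet\<close> is the inequality for
  down-closed finite sets under an arbitrary relation.
\<close>

section \<open>The four functions theorem\<close>

text \<open>
  The four functions theorem on a one-point ground set. The mixed terms carry the difficulty:
  both \<open>a0 * b1\<close> and \<open>a1 * b0\<close> are bounded by the same number \<open>p = c1 * d0\<close>, while their product
  is at most \<open>p * (c0 * d1)\<close>. If \<open>p > 0\<close>, two numbers up to \<open>p\<close> with product at most \<open>p * q\<close> have sum at most
  \<open>p + q\<close>, because \<open>(p - u) * (p - v) \<ge> 0\<close>.
\<close>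

lemma two_point_four_functions:
  fixes a0 a1 b0 b1 c0 c1 d0 d1 :: real
  assumes nn: "0 \<le> a0" "0 \<le> a1" "0 \<le> b0" "0 \<le> b1" "0 \<le> c0" "0 \<le> c1" "0 \<le> d0" "0 \<le> d1"
    and h00: "a0 * b0 \<le> c0 * d0" and h01: "a0 * b1 \<le> c1 * d0"
    and h10: "a1 * b0 \<le> c1 * d0" and h11: "a1 * b1 \<le> c1 * d1"
  shows "(a0 + a1) * (b0 + b1) \<le> (c0 + c1) * (d0 + d1)"
proof -
  have key: "a0 * b1 + a1 * b0 \<le> c1 * d0 + c0 * d1"
  proof (cases "c1 * d0 = 0")
    case True
    then have "a0 * b1 + a1 * b0 \<le> 0" using h01 h10 by linarith
    also have "0 \<le> c1 * d0 + c0 * d1" using nn by simp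
    finally show ?thesis .
  next
    case False
    then have pos: "0 < c1 * d0" using nn by (simp add: less_le)
    have "(a0 * b0) * (a1 * b1) \<le> (c0 * d0) * (c1 * d1)"
      by (rule mult_mono[OF h00 h11]) (use nn in simp_all)
    moreover have "0 \<le> (c1 * d0 - a0 * b1) * (c1 * d0 - a1 * b0)"
      using h01 h10 by simp
    ultimately have "(a0 * b1 + a1 * b0) * (c1 * d0) \<le> (c1 * d0 + c0 * d1) * (c1 * d0)"
      by (simp add: algebra_simps)
    then show ?thesis using pos by (simp only: mult_le_cancel_right)
  qed
  show ?thesis using key h00 h11 by (simp add: algebra_simps)
qed

text \<open>
  Ahlswede and Daykin's theorem for the subsets of a finite set. Removing a point \<open>x\<close> from the
  ground set replaces each \<open>f\<close> by \<open>X \<mapsto> f X + f (insert x X)\<close>, which keeps the sums, and the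
  one-point case says that the hypothesis survives.
\<close>

theorem four_functions:
  fixes f1 f2 f3 f4 :: "'a set \<Rightarrow> real"
  assumes "finite U"
    and "\<And>X. X \<subseteq> U \<Longrightarrow> 0 \<le> f1 X" "\<And>X. X \<subseteq> U \<Longrightarrow> 0 \<le> f2 X"
    and "\<And>X. X \<subseteq> U \<Longrightarrow> 0 \<le> f3 X" "\<And>X. X \<subseteq> U \<Longrightarrow> 0 \<le> f4 X"
    and "\<And>X Y. X \<subseteq> U \<Longrightarrow> Y \<subseteq> U \<Longrightarrow> f1 X * f2 Y \<le> f3 (X \<union> Y) * f4 (X \<inter> Y)"
  shows "sum f1 (Pow U) * sum f2 (Pow U) \<le> sum f3 (Pow U) * sum f4 (Pow U)"
  using assms
proof (induction U arbitrary: f1 f2 f3 f4 rule: finite_induct)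
  case empty
  then show ?case by (auto dest!: empty.prems(5)[of "{}" "{}"])
next
  case (insert x U)
  define g where "g f X = f X + f (insert x X)" for f :: "'a set \<Rightarrow> real" and X
  have split: "sum f (Pow (insert x U)) = sum (g f) (Pow U)" for f :: "'a set \<Rightarrow> real"
  proof -
    have "inj_on (insert x) (Pow U)"
      using insert.hyps(2) by (auto simp: inj_on_def)
    moreover have "Pow U \<inter> insert x ` Pow U = {}"
      using insert.hyps(2) by auto
    ultimately show ?thesis
      using insert.hyps(1) by (simp add: Pow_insert sum.union_disjoint sum.reindex g_def sum.distrib)
  qed
  have sub: "X \<subseteq> insert x U" "insert x X \<subseteq> insert x U" if "X \<subseteq> U" for X
    using that by auto
  have "sum (g f1) (Pow U) * sum (g f2) (Pow U) \<le> sum (g f3) (Pow U) * sum (g f4) (Pow U)"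
  proof (rule insert.IH)
    fix X Y assume X: "X \<subseteq> U" and Y: "Y \<subseteq> U"
    have "x \<notin> X" "x \<notin> Y" using X Y insert.hyps(2) by auto
    then show "g f1 X * g f2 Y \<le> g f3 (X \<union> Y) * g f4 (X \<inter> Y)"
      unfolding g_def
      using insert.prems(5)[OF sub(1)[OF X] sub(1)[OF Y]] insert.prems(5)[OF sub(1)[OF X] sub(2)[OF Y]]
        insert.prems(5)[OF sub(2)[OF X] sub(1)[OF Y]] insert.prems(5)[OF sub(2)[OF X] sub(2)[OF Y]] X Y
      by (intro two_point_four_functions insert.prems(1-4)) auto
  qed (auto simp: g_def intro!: add_nonneg_nonneg insert.prems(1-4))
  then show ?case by (simp only: split)
qed

text \<open>The four functions theorem for the indicator functions of four set families.\<close>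

corollary card_join_meet_families:
  assumes fin: "finite C" "finite D" "\<And>X. X \<in> A \<union> B \<union> C \<union> D \<Longrightarrow> finite X"
    and fAB: "finite A" "finite B"
    and join: "\<And>X Y. X \<in> A \<Longrightarrow> Y \<in> B \<Longrightarrow> X \<union> Y \<in> C"
    and meet: "\<And>X Y. X \<in> A \<Longrightarrow> Y \<in> B \<Longrightarrow> X \<inter> Y \<in> D"
  shows "card A * card B \<le> card C * card D"
proof -
  define U where "U = \<Union>(A \<union> B \<union> C \<union> D)"
  have U: "finite U" unfolding U_def using assms by blast
  have card: "sum (\<lambda>X. of_bool (X \<in> F)) (Pow U) = real (card F)" if "F \<subseteq> A \<union> B \<union> C \<union> D" for F
  proof -
    have "Pow U \<inter> F = F" using that by (auto simp: U_def)
    then show ?thesis using U by (simp add: sum.If_cases of_bool_def)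
  qed
  have "real (card A) * real (card B) \<le> real (card C) * real (card D)"
    using four_functions[OF U, of "\<lambda>X. of_bool (X \<in> A)" "\<lambda>X. of_bool (X \<in> B)"
        "\<lambda>X. of_bool (X \<in> C)" "\<lambda>X. of_bool (X \<in> D)"] join meet
    by (simp add: card le_supI1 le_supI2)
  then show ?thesis by (simp only: of_nat_mult[symmetric] of_nat_le_iff)
qed

section \<open>Counting order-preserving maps on joins and meets of skew shapes\<close>

definition order_maps :: "('a \<Rightarrow> 'a \<Rightarrow> bool) \<Rightarrow> 'a set \<Rightarrow> nat set \<Rightarrow> ('a \<Rightarrow> nat) set" where
  "order_maps R D S = {s \<in> D \<rightarrow>\<^sub>E S. \<forall>c\<in>D. \<forall>d\<in>D. R c d \<longrightarrow> s c \<le> s d}"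

lemma finite_order_maps: "finite D \<Longrightarrow> finite S \<Longrightarrow> finite (order_maps R D S)"
  by (simp add: order_maps_def finite_PiE)

text \<open>
  For \<open>S = {1..card D}\<close> these are the linear extensions of \<open>R\<close> on \<open>D\<close>. The general label set \<open>S\<close>
  is there to count injective maps into \<open>{1..t}\<close> by their image.
\<close>

definition linear_exts :: "('a \<Rightarrow> 'a \<Rightarrow> bool) \<Rightarrow> 'a set \<Rightarrow> nat set \<Rightarrow> ('a \<Rightarrow> nat) set" where
  "linear_exts R D S = {s \<in> order_maps R D S. inj_on s D}"

definition down_closed :: "('a \<Rightarrow> 'a \<Rightarrow> bool) \<Rightarrow> 'a set \<Rightarrow> bool" where
  "down_closed R D \<longleftrightarrow> (\<forall>c d. R c d \<longrightarrow> d \<in> D \<longrightarrow> c \<in> D)"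

text \<open>
  The total extension of an order-preserving map \<open>\<mu> - \<alpha> \<rightarrow> {1..t}\<close>, by the value \<open>0\<close> below and
  \<open>t + 1\<close> above. The equivalences make the two sets recoverable from the map, so that pointwise
  minima and maxima act on the shapes as well.
\<close>

definition framed_maps :: "('a \<Rightarrow> 'a \<Rightarrow> bool) \<Rightarrow> 'a set \<Rightarrow> 'a set \<Rightarrow> nat \<Rightarrow> ('a \<Rightarrow> nat) set" where
  "framed_maps R \<alpha> \<mu> t = {h. (\<forall>c d. R c d \<longrightarrow> h c \<le> h d) \<and> (\<forall>c. h c \<le> Suc t)
     \<and> (\<forall>c. h c = 0 \<longleftrightarrow> c \<in> \<alpha>) \<and> (\<forall>c. h c = Suc t \<longleftrightarrow> c \<notin> \<mu>)}"

text \<open>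
  Down-closedness is what makes the extension monotone: a relation \<open>R c d\<close> never leads from outside
  \<open>\<mu>\<close> (value \<open>t + 1\<close>) into \<open>\<mu>\<close>, nor from outside \<open>\<alpha>\<close> into \<open>\<alpha>\<close> (value \<open>0\<close>).
\<close>

lemma bij_betw_framed_maps_order_maps:
  assumes "down_closed R \<mu>" "down_closed R \<alpha>" "\<alpha> \<subseteq> \<mu>"
  shows "bij_betw (\<lambda>h. restrict h (\<mu> - \<alpha>)) (framed_maps R \<alpha> \<mu> t) (order_maps R (\<mu> - \<alpha>) {1..t})"
proof (rule bij_betw_byWitness[where
      f' = "\<lambda>s c. if c \<in> \<alpha> then 0 else if c \<in> \<mu> then s c else Suc t"])
  show "\<forall>h\<in>framed_maps R \<alpha> \<mu> t. (\<lambda>c. if c \<in> \<alpha> then 0 else if c \<in> \<mu>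
      then restrict h (\<mu> - \<alpha>) c else Suc t) = h"
    by (force simp: framed_maps_def fun_eq_iff)
  show "\<forall>s\<in>order_maps R (\<mu> - \<alpha>) {1..t}. restrict (\<lambda>c. if c \<in> \<alpha> then 0 else if c \<in> \<mu>
      then s c else Suc t) (\<mu> - \<alpha>) = s"
    by (auto simp: order_maps_def fun_eq_iff PiE_def extensional_def)
  show "(\<lambda>h. restrict h (\<mu> - \<alpha>)) ` framed_maps R \<alpha> \<mu> t \<subseteq> order_maps R (\<mu> - \<alpha>) {1..t}"
  proof (safe)
    fix h assume h: "h \<in> framed_maps R \<alpha> \<mu> t"
    have "1 \<le> h c \<and> h c \<le> t" if "c \<in> \<mu> - \<alpha>" for c
    proof -
      have "h c \<noteq> 0" "h c \<noteq> Suc t" "h c \<le> Suc t"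
        using h that by (auto simp: framed_maps_def)
      then show ?thesis by linarith
    qed
    then show "restrict h (\<mu> - \<alpha>) \<in> order_maps R (\<mu> - \<alpha>) {1..t}"
      using h by (auto simp: order_maps_def framed_maps_def)
  qed
  show "(\<lambda>s c. if c \<in> \<alpha> then 0 else if c \<in> \<mu> then s c else Suc t) ` order_maps R (\<mu> - \<alpha>) {1..t}
      \<subseteq> framed_maps R \<alpha> \<mu> t"
  proof (safe)
    fix s assume s: "s \<in> order_maps R (\<mu> - \<alpha>) {1..t}"
    have "1 \<le> s c \<and> s c \<le> t" if "c \<in> \<mu> - \<alpha>" for c
      using s that by (auto simp: order_maps_def PiE_def Pi_def)
    then have range: "s c \<noteq> 0" "s c \<noteq> Suc t" "s c \<le> Suc t" if "c \<in> \<mu>" "c \<notin> \<alpha>" for c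
      using that by (metis DiffI not_one_le_zero, metis DiffI Suc_n_not_le_n, metis DiffI le_SucI)
    have mono: "s c \<le> s d" if "R c d" "c \<in> \<mu>" "c \<notin> \<alpha>" "d \<in> \<mu>" "d \<notin> \<alpha>" for c d
      using s that by (auto simp: order_maps_def)
    have closed: "d \<in> \<mu> \<Longrightarrow> c \<in> \<mu>" "d \<in> \<alpha> \<Longrightarrow> c \<in> \<alpha>" if "R c d" for c d
      using assms that by (auto simp: down_closed_def)
    show "(\<lambda>c. if c \<in> \<alpha> then 0 else if c \<in> \<mu> then s c else Suc t) \<in> framed_maps R \<alpha> \<mu> t"
      using range mono closed assms(3) by (auto simp: framed_maps_def split: if_splits)
  qed
qed

text \<open>
  A minimum is \<open>0\<close> when one of the values is, and \<open>t + 1\<close> only when both are; so the inner shapes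
  and the outer shapes are both united. Dually, a maximum intersects them.
\<close>

lemma framed_maps_min:
  assumes "h \<in> framed_maps R \<alpha> \<mu> t" "g \<in> framed_maps R \<beta> \<nu> t"
  shows "(\<lambda>c. min (h c) (g c)) \<in> framed_maps R (\<alpha> \<union> \<beta>) (\<mu> \<union> \<nu>) t"
proof -
  have "min (h c) (g c) = Suc t \<longleftrightarrow> h c = Suc t \<and> g c = Suc t" for c
  proof -
    have "h c \<le> Suc t" "g c \<le> Suc t" using assms by (auto simp: framed_maps_def)
    then show ?thesis by linarith
  qed
  moreover have "min a b = 0 \<longleftrightarrow> a = 0 \<or> b = 0" for a b :: nat
    by auto
  ultimately show ?thesis
    using assms by (auto simp: framed_maps_def min.coboundedI1 min.coboundedI2)
qed

lemma framed_maps_max: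
  assumes "h \<in> framed_maps R \<alpha> \<mu> t" "g \<in> framed_maps R \<beta> \<nu> t"
  shows "(\<lambda>c. max (h c) (g c)) \<in> framed_maps R (\<alpha> \<inter> \<beta>) (\<mu> \<inter> \<nu>) t"
proof -
  have "max (h c) (g c) = Suc t \<longleftrightarrow> h c = Suc t \<or> g c = Suc t" for c
  proof -
    have "h c \<le> Suc t" "g c \<le> Suc t" using assms by (auto simp: framed_maps_def)
    then show ?thesis by linarith
  qed
  moreover have "max a b = 0 \<longleftrightarrow> a = 0 \<and> b = 0" for a b :: nat
    by auto
  ultimately show ?thesis
    using assms by (auto simp: framed_maps_def max.coboundedI1 max.coboundedI2)
qed

text \<open>
  Cutting the region above the graph at height \<open>t\<close> makes it finite and loses nothing, since
  \<open>t + 1\<close> is the only value without a point in it.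
\<close>

definition epigraph :: "nat \<Rightarrow> ('a \<Rightarrow> nat) \<Rightarrow> ('a \<times> nat) set" where
  "epigraph t h = {(c, k). h c \<le> k \<and> k \<le> t}"

lemma inj_on_epigraph: "inj_on (epigraph t) (framed_maps R \<alpha> \<mu> t)"
proof (rule inj_onI)
  fix h g assume h: "h \<in> framed_maps R \<alpha> \<mu> t" and g: "g \<in> framed_maps R \<alpha> \<mu> t"
    and eq: "epigraph t h = epigraph t g"
  have *: "h c \<le> k \<longleftrightarrow> g c \<le> k" if "k \<le> t" for c k
    using eq that by (auto simp: epigraph_def set_eq_iff)
  show "h = g"
  proof
    fix c
    have "h c \<le> Suc t" "g c \<le> Suc t" using h g by (auto simp: framed_maps_def)
    then show "h c = g c"
      using *[of "h c" c] *[of "g c" c] by (metis le_SucE order_refl antisym)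
  qed
qed

lemma epigraph_subset: "h \<in> framed_maps R \<alpha> \<mu> t \<Longrightarrow> epigraph t h \<subseteq> \<mu> \<times> {..t}"
  by (force simp: framed_maps_def epigraph_def)

lemma epigraph_min: "epigraph t (\<lambda>c. min (h c) (g c)) = epigraph t h \<union> epigraph t g"
  by (auto simp: epigraph_def)

lemma epigraph_max: "epigraph t (\<lambda>c. max (h c) (g c)) = epigraph t h \<inter> epigraph t g"
  by (auto simp: epigraph_def)

text \<open>
  The comparison of order polynomials. The families of epigraphs have the cardinalities in question,
  and are related by union and intersection as \<open>card_join_meet_families\<close> demands.
\<close>

lemma card_order_maps_join_meet:
  assumes fin: "finite \<mu>" "finite \<nu>"
    and down: "down_closed R \<mu>" "down_closed R \<alpha>" "down_closed R \<nu>" "down_closed R \<beta>"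
    and sub: "\<alpha> \<subseteq> \<mu>" "\<beta> \<subseteq> \<nu>"
  shows "card (order_maps R (\<mu> - \<alpha>) {1..t}) * card (order_maps R (\<nu> - \<beta>) {1..t})
    \<le> card (order_maps R (\<mu> \<union> \<nu> - (\<alpha> \<union> \<beta>)) {1..t})
      * card (order_maps R (\<mu> \<inter> \<nu> - \<alpha> \<inter> \<beta>) {1..t})"
proof -
  define E where "E a m = epigraph t ` framed_maps R a m t" for a m
  have fin_elem: "finite X" if "X \<in> E a m" "finite m" for X a m
    using that epigraph_subset[of _ R a m t] unfolding E_def
    by (metis (no_types, lifting) finite_SigmaI finite_atMost finite_subset imageE)
  have fin_fam: "finite (E a m)" if "finite m" for a m
  proof (rule finite_subset)
    show "E a m \<subseteq> Pow (m \<times> {..t})" unfolding E_def using epigraph_subset by blast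
  qed (use that in auto)
  have card_E: "card (E a m) = card (order_maps R (m - a) {1..t})"
    if "down_closed R m" "down_closed R a" "a \<subseteq> m" for a m
    using bij_betw_same_card[OF bij_betw_framed_maps_order_maps[OF that, of t]]
      card_image[OF inj_on_epigraph[of t R a m]] by (simp add: E_def)
  have "card (E \<alpha> \<mu>) * card (E \<beta> \<nu>) \<le> card (E (\<alpha> \<union> \<beta>) (\<mu> \<union> \<nu>)) * card (E (\<alpha> \<inter> \<beta>) (\<mu> \<inter> \<nu>))"
  proof (rule card_join_meet_families)
    fix X Y assume "X \<in> E \<alpha> \<mu>" "Y \<in> E \<beta> \<nu>"
    then show "X \<union> Y \<in> E (\<alpha> \<union> \<beta>) (\<mu> \<union> \<nu>)" "X \<inter> Y \<in> E (\<alpha> \<inter> \<beta>) (\<mu> \<inter> \<nu>)"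
      using framed_maps_min[of _ R \<alpha> \<mu> t _ \<beta> \<nu>] framed_maps_max[of _ R \<alpha> \<mu> t _ \<beta> \<nu>]
      unfolding E_def by (auto simp: epigraph_min[symmetric] epigraph_max[symmetric])
  qed (use fin fin_fam in \<open>auto intro: fin_elem\<close>)
  moreover have "down_closed R (\<mu> \<union> \<nu>)" "down_closed R (\<alpha> \<union> \<beta>)"
    "down_closed R (\<mu> \<inter> \<nu>)" "down_closed R (\<alpha> \<inter> \<beta>)"
    using down by (auto simp: down_closed_def)
  moreover have "\<alpha> \<union> \<beta> \<subseteq> \<mu> \<union> \<nu>" "\<alpha> \<inter> \<beta> \<subseteq> \<mu> \<inter> \<nu>" using sub by auto
  ultimately show ?thesis using down sub by (simp add: card_E)
qed

section \<open>The leading coefficient of the order polynomial\<close>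

lemma strict_mono_bij_between_finite_sets:
  fixes S S' :: "nat set"
  assumes "finite S" "finite S'" "card S = card S'"
  obtains e where "bij_betw e S S'" "\<And>x y. x \<in> S \<Longrightarrow> y \<in> S \<Longrightarrow> e x \<le> e y \<longleftrightarrow> x \<le> y"
proof -
  obtain f where f: "bij_betw f {..<card S} S" "strict_mono_on {..<card S} f"
    using ex_bij_betw_strict_mono_card[OF assms(1)] .
  obtain f' where f': "bij_betw f' {..<card S} S'" "strict_mono_on {..<card S} f'"
    using ex_bij_betw_strict_mono_card[OF assms(2)] assms(3) by metis
  let ?i = "inv_into {..<card S} f"
  have "bij_betw (f' \<circ> ?i) S S'"
    using bij_betw_trans[OF bij_betw_inv_into[OF f(1)] f'(1)] .
  moreover have "(f' \<circ> ?i) x \<le> (f' \<circ> ?i) y \<longleftrightarrow> x \<le> y" if "x \<in> S" "y \<in> S" for x y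
  proof -
    have i: "?i z \<in> {..<card S}" "f (?i z) = z" if "z \<in> S" for z
      using f(1) that by (auto simp: bij_betw_def inv_into_into f_inv_into_f simp del: lessThan_iff)
    show ?thesis
      using strict_mono_on_less_eq[OF f(2) i(1)[OF that(1)] i(1)[OF that(2)]]
        strict_mono_on_less_eq[OF f'(2) i(1)[OF that(1)] i(1)[OF that(2)]] i(2) that by simp
  qed
  ultimately show ?thesis using that by blast
qed

lemma linear_exts_relabel:
  assumes s: "s \<in> linear_exts R D S"
    and e: "\<And>x. x \<in> S \<Longrightarrow> e x \<in> S'" "\<And>x y. x \<in> S \<Longrightarrow> y \<in> S \<Longrightarrow> e x \<le> e y \<longleftrightarrow> x \<le> y"
  shows "(\<lambda>c\<in>D. e (s c)) \<in> linear_exts R D S'"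
proof -
  have S: "s c \<in> S" if "c \<in> D" for c
    using s that by (auto simp: linear_exts_def order_maps_def)
  have inj: "s c = s d \<Longrightarrow> c = d" if "c \<in> D" "d \<in> D" for c d
    using s that by (auto simp: linear_exts_def inj_on_def)
  have mono: "R c d \<Longrightarrow> s c \<le> s d" if "c \<in> D" "d \<in> D" for c d
    using s that by (auto simp: linear_exts_def order_maps_def)
  have "c = d" if "c \<in> D" "d \<in> D" "e (s c) = e (s d)" for c d
    using e(2)[of "s c" "s d"] e(2)[of "s d" "s c"] S inj that by simp
  then show ?thesis
    using S mono e by (auto simp: linear_exts_def order_maps_def inj_on_def)
qed

lemma card_linear_exts_cong:
  assumes "finite S" "finite S'" "card S = card S'"
  shows "card (linear_exts R D S) = card (linear_exts R D S')"
proof -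
  obtain e where e: "bij_betw e S S'" and mono: "\<And>x y. x \<in> S \<Longrightarrow> y \<in> S \<Longrightarrow> e x \<le> e y \<longleftrightarrow> x \<le> y"
    using strict_mono_bij_between_finite_sets[OF assms] by blast
  let ?i = "inv_into S e"
  have i: "?i y \<in> S" "e (?i y) = y" if "y \<in> S'" for y
    using e that by (auto simp: bij_betw_def inv_into_into f_inv_into_f)
  have ie: "?i (e x) = x" "e x \<in> S'" if "x \<in> S" for x
    using e that by (auto simp: bij_betw_def)
  have "bij_betw (\<lambda>s. \<lambda>c\<in>D. e (s c)) (linear_exts R D S) (linear_exts R D S')"
  proof (rule bij_betw_byWitness[where f' = "\<lambda>s. \<lambda>c\<in>D. ?i (s c)"])
    show "\<forall>s\<in>linear_exts R D S. (\<lambda>c\<in>D. ?i ((\<lambda>c\<in>D. e (s c)) c)) = s"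
      using ie by (auto simp: linear_exts_def order_maps_def fun_eq_iff PiE_def extensional_def Pi_def)
    show "\<forall>s\<in>linear_exts R D S'. (\<lambda>c\<in>D. e ((\<lambda>c\<in>D. ?i (s c)) c)) = s"
      using i by (auto simp: linear_exts_def order_maps_def fun_eq_iff PiE_def extensional_def Pi_def)
    show "(\<lambda>s. \<lambda>c\<in>D. e (s c)) ` linear_exts R D S \<subseteq> linear_exts R D S'"
      using linear_exts_relabel[OF _ ie(2) mono] by blast
    have imono: "?i x \<le> ?i y \<longleftrightarrow> x \<le> y" if "x \<in> S'" "y \<in> S'" for x y
      using mono[of "?i x" "?i y"] i that by simp
    show "(\<lambda>s. \<lambda>c\<in>D. ?i (s c)) ` linear_exts R D S' \<subseteq> linear_exts R D S"
      using linear_exts_relabel[OF _ i(1) imono] by blast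
  qed
  then show ?thesis by (rule bij_betw_same_card)
qed

text \<open>
  An injective order-preserving map is a choice of its image, a set of \<open>card D\<close> labels, followed by
  a linear extension with these labels in place of \<open>1, ..., card D\<close>.
\<close>

lemma card_linear_exts:
  assumes "finite D"
  shows "card (linear_exts R D {1..t}) = (t choose card D) * card (linear_exts R D {1..card D})"
proof -
  let ?F = "{S. S \<subseteq> {1..t} \<and> card S = card D}"
  have finF: "finite ?F" by simp
  have surj: "s ` D = S" if "S \<in> ?F" "s \<in> linear_exts R D S" for s S
  proof (rule card_subset_eq)
    show "finite S" using that(1) finite_subset by blast
    show "s ` D \<subseteq> S" "card (s ` D) = card S"
      using that by (auto simp: linear_exts_def order_maps_def card_image)
  qed
  have union: "linear_exts R D {1..t} = (\<Union>S\<in>?F. linear_exts R D S)"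
  proof (intro equalityI subsetI)
    fix s assume s: "s \<in> linear_exts R D {1..t}"
    then have "s ` D \<in> ?F" "s \<in> linear_exts R D (s ` D)"
      by (auto simp: linear_exts_def order_maps_def card_image PiE_def Pi_def)
    then show "s \<in> (\<Union>S\<in>?F. linear_exts R D S)" by blast
  qed (auto simp: linear_exts_def order_maps_def PiE_def Pi_def)
  have "card (linear_exts R D {1..t}) = (\<Sum>S\<in>?F. card (linear_exts R D S))"
    unfolding union
  proof (rule card_UN_disjoint)
    show "\<forall>S\<in>?F. finite (linear_exts R D S)"
      using finite_order_maps[OF assms] finite_subset[OF _ finite_atLeastAtMost[of 1 t]]
      by (simp add: linear_exts_def)
    show "\<forall>S\<in>?F. \<forall>S'\<in>?F. S \<noteq> S' \<longrightarrow> linear_exts R D S \<inter> linear_exts R D S' = {}"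
    proof (intro ballI impI)
      fix S S' assume S: "S \<in> ?F" "S' \<in> ?F" "S \<noteq> S'"
      have False if "s \<in> linear_exts R D S" "s \<in> linear_exts R D S'" for s
        using surj[OF S(1) that(1)] surj[OF S(2) that(2)] S(3) by simp
      then show "linear_exts R D S \<inter> linear_exts R D S' = {}" by blast
    qed
  qed (rule finF)
  also have "\<dots> = (\<Sum>S\<in>?F. card (linear_exts R D {1..card D}))"
    by (intro sum.cong card_linear_exts_cong) (auto intro: finite_subset)
  also have "\<dots> = (t choose card D) * card (linear_exts R D {1..card D})"
    using n_subsets[of "{1..t}" "card D"] by simp
  finally show ?thesis .
qed

lemma tendsto_binomial_over_power:
  "(\<lambda>t. real (t choose n) / real t ^ n) \<longlonglongrightarrow> 1 / fact n"
proof -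
  have "(\<lambda>t. (real t - real i) / real t) \<longlonglongrightarrow> 1" for i
  proof -
    have "(\<lambda>t. 1 - real i * inverse (real t)) \<longlonglongrightarrow> 1 - real i * 0"
      by (intro tendsto_diff tendsto_mult tendsto_const lim_inverse_n)
    moreover have "\<forall>\<^sub>F t in sequentially. 1 - real i * inverse (real t) = (real t - real i) / real t"
      using eventually_gt_at_top[of 0] by eventually_elim (simp add: field_simps)
    ultimately have "(\<lambda>t. (real t - real i) / real t) \<longlonglongrightarrow> 1 - real i * 0"
      by (rule Lim_transform_eventually)
    then show ?thesis by simp
  qed
  then have "(\<lambda>t. (\<Prod>i<n. (real t - real i) / real t) / fact n) \<longlonglongrightarrow> (\<Prod>i<n. 1) / fact n"
    by (intro tendsto_divide tendsto_prod tendsto_const) auto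
  moreover have "(\<Prod>i<n. (real t - real i) / real t) / fact n = real (t choose n) / real t ^ n" for t
    by (simp add: binomial_gbinomial gbinomial_prod_rev prod_dividef lessThan_atLeast0)
  ultimately show ?thesis by simp
qed

text \<open>
  The injective maps alone give the lower bound. For the upper bound add all non-injective maps
  \<open>D \<rightarrow> {1..t}\<close>, order-preserving or not: a proportion
  \<open>1 - n! (t choose n) / t\<^sup>n\<close> of all maps, which tends to \<open>0\<close>.
\<close>

lemma tendsto_order_maps_over_power:
  assumes "finite D"
  shows "(\<lambda>t. real (card (order_maps R D {1..t})) / real t ^ card D)
    \<longlonglongrightarrow> real (card (linear_exts R D {1..card D})) / fact (card D)"
proof -
  let ?n = "card D" and ?l = "real (card (linear_exts R D {1..card D}))"
  let ?b = "\<lambda>t. real (t choose ?n) / real t ^ ?n"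
  have lower: "?l * ?b t \<le> real (card (order_maps R D {1..t})) / real t ^ ?n" for t
  proof -
    have "card (linear_exts R D {1..t}) \<le> card (order_maps R D {1..t})"
      using assms by (intro card_mono finite_order_maps) (auto simp: linear_exts_def)
    then have "?l * real (t choose ?n) \<le> real (card (order_maps R D {1..t}))"
      by (metis card_linear_exts[OF assms] mult.commute of_nat_le_iff of_nat_mult)
    then show ?thesis by (simp add: divide_right_mono)
  qed
  have upper: "real (card (order_maps R D {1..t})) / real t ^ ?n \<le> ?l * ?b t + (1 - fact ?n * ?b t)"
    if "t \<ge> max 1 ?n" for t
  proof -
    let ?N = "{s \<in> D \<rightarrow>\<^sub>E {1..t}. \<not> inj_on s D}" and ?I = "{s \<in> D \<rightarrow>\<^sub>E {1..t}. inj_on s D}"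
    have finE: "finite (D \<rightarrow>\<^sub>E {1..t})" using assms by (simp add: finite_PiE)
    \<comment> \<open>The count of injective maps is a product of truncated differences \<open>t - i\<close>; for \<open>t \<ge> n\<close>
      they are true differences.\<close>
    have "real (card ?I) = (\<Prod>i<?n. real t - real i)"
      using card_inj_on_subset_funcset[OF assms finite_atLeastAtMost[of 1 t] order_refl] that
      by (simp add: lessThan_atLeast0 of_nat_diff)
    also have "\<dots> = fact ?n * real (t choose ?n)"
      by (simp add: binomial_gbinomial gbinomial_prod_rev lessThan_atLeast0)
    finally have I: "real (card ?I) = fact ?n * real (t choose ?n)" .
    have "card ?I + card ?N = card (?I \<union> ?N)"
      using finE by (intro card_Un_disjoint[symmetric]) auto
    also have "?I \<union> ?N = D \<rightarrow>\<^sub>E {1..t}" by auto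
    also have "card \<dots> = t ^ ?n" using assms by (simp add: card_PiE)
    finally have "real (card ?I) + real (card ?N) = real t ^ ?n"
      by (simp only: of_nat_add[symmetric] of_nat_power)
    then have N: "real (card ?N) = real t ^ ?n - fact ?n * real (t choose ?n)"
      using I by linarith
    have "card (order_maps R D {1..t}) \<le> card (linear_exts R D {1..t} \<union> ?N)"
      using assms finE finite_order_maps[OF assms, of "{1..t}" R]
      by (intro card_mono) (auto simp: linear_exts_def order_maps_def)
    also have "\<dots> \<le> card (linear_exts R D {1..t}) + card ?N" by (rule card_Un_le)
    finally have "real (card (order_maps R D {1..t}))
        \<le> real (card (linear_exts R D {1..t})) + real (card ?N)"
      by (simp only: of_nat_add[symmetric] of_nat_le_iff)
    also have "real (card (linear_exts R D {1..t})) = ?l * real (t choose ?n)"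
      by (subst card_linear_exts[OF assms]) (simp only: of_nat_mult mult.commute)
    also note N
    finally have "real (card (order_maps R D {1..t}))
        \<le> ?l * real (t choose ?n) + (real t ^ ?n - fact ?n * real (t choose ?n))" .
    then have "real (card (order_maps R D {1..t})) / real t ^ ?n
        \<le> (?l * real (t choose ?n) + (real t ^ ?n - fact ?n * real (t choose ?n))) / real t ^ ?n"
      by (rule divide_right_mono) simp
    also have "\<dots> = ?l * ?b t + (1 - fact ?n * ?b t)"
      using that by (simp add: add_divide_distrib diff_divide_distrib)
    finally show ?thesis .
  qed
  note b = tendsto_binomial_over_power[of ?n]
  show ?thesis
  proof (rule tendsto_sandwich)
    show "(\<lambda>t. ?l * ?b t) \<longlonglongrightarrow> ?l / fact ?n"
      using tendsto_mult_left[OF b, of ?l] by simp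
    have "(\<lambda>t. ?l * ?b t + (1 - fact ?n * ?b t)) \<longlonglongrightarrow> ?l * (1 / fact ?n) + (1 - fact ?n * (1 / fact ?n))"
      by (intro tendsto_add tendsto_diff tendsto_mult tendsto_const b)
    then show "(\<lambda>t. ?l * ?b t + (1 - fact ?n * ?b t)) \<longlonglongrightarrow> ?l / fact ?n" by simp
  qed (use lower upper eventually_ge_at_top[of "max 1 ?n"] in \<open>auto elim!: eventually_mono\<close>)
qed

section \<open>The inequality for linear extensions and for standard tableaux\<close>

text \<open>
  The limit of the comparison of order polynomials: both sides have the same degree in \<open>t\<close>, by
  inclusion-exclusion, so the inequality passes to the leading coefficients.
\<close>

theorem linear_exts_join_meet:
  assumes fin: "finite \<mu>" "finite \<nu>"
    and down: "down_closed R \<mu>" "down_closed R \<alpha>" "down_closed R \<nu>" "down_closed R \<beta>"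
    and sub: "\<alpha> \<subseteq> \<mu>" "\<beta> \<subseteq> \<nu>"
  defines "r \<equiv> \<lambda>D. real (card (linear_exts R D {1..card D})) / fact (card D)"
  shows "r (\<mu> - \<alpha>) * r (\<nu> - \<beta>) \<le> r (\<mu> \<union> \<nu> - (\<alpha> \<union> \<beta>)) * r (\<mu> \<inter> \<nu> - \<alpha> \<inter> \<beta>)"
proof -
  define q where "q D t = real (card (order_maps R D {1..t})) / real t ^ card D" for D t
  have lim: "q D \<longlonglongrightarrow> r D" if "finite D" for D
    using tendsto_order_maps_over_power[OF that, of R] by (simp add: q_def[abs_def] r_def)
  have fin': "finite (\<mu> - \<alpha>)" "finite (\<nu> - \<beta>)" "finite (\<mu> \<union> \<nu> - (\<alpha> \<union> \<beta>))" "finite (\<mu> \<inter> \<nu> - \<alpha> \<inter> \<beta>)"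
    using fin by auto
  have fa: "finite \<alpha>" "finite \<beta>" using fin sub finite_subset by auto
  have size: "card (\<mu> - \<alpha>) + card (\<nu> - \<beta>) = card (\<mu> \<union> \<nu> - (\<alpha> \<union> \<beta>)) + card (\<mu> \<inter> \<nu> - \<alpha> \<inter> \<beta>)"
  proof -
    have "card \<mu> = card (\<mu> - \<alpha>) + card \<alpha>" "card \<nu> = card (\<nu> - \<beta>) + card \<beta>"
      using sub fin fa by (simp_all add: card_Diff_subset card_mono)
    moreover have "card (\<mu> \<union> \<nu>) = card (\<mu> \<union> \<nu> - (\<alpha> \<union> \<beta>)) + card (\<alpha> \<union> \<beta>)"
      using sub fin fa by (subst card_Diff_subset) (auto intro!: card_mono le_add_diff_inverse2[symmetric])
    moreover have "card (\<mu> \<inter> \<nu>) = card (\<mu> \<inter> \<nu> - \<alpha> \<inter> \<beta>) + card (\<alpha> \<inter> \<beta>)"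
      using sub fin fa by (subst card_Diff_subset) (auto intro!: card_mono le_add_diff_inverse2[symmetric])
    ultimately show ?thesis
      using card_Un_Int[OF fin] card_Un_Int[OF fa] by linarith
  qed
  show ?thesis
  proof (rule LIMSEQ_le)
    show "(\<lambda>t. q (\<mu> - \<alpha>) t * q (\<nu> - \<beta>) t) \<longlonglongrightarrow> r (\<mu> - \<alpha>) * r (\<nu> - \<beta>)"
      by (intro tendsto_mult lim fin')
    show "(\<lambda>t. q (\<mu> \<union> \<nu> - (\<alpha> \<union> \<beta>)) t * q (\<mu> \<inter> \<nu> - \<alpha> \<inter> \<beta>) t)
        \<longlonglongrightarrow> r (\<mu> \<union> \<nu> - (\<alpha> \<union> \<beta>)) * r (\<mu> \<inter> \<nu> - \<alpha> \<inter> \<beta>)"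
      by (intro tendsto_mult lim fin')
    have "q (\<mu> - \<alpha>) t * q (\<nu> - \<beta>) t \<le> q (\<mu> \<union> \<nu> - (\<alpha> \<union> \<beta>)) t * q (\<mu> \<inter> \<nu> - \<alpha> \<inter> \<beta>) t" for t
      using card_order_maps_join_meet[OF fin down sub, of t]
      unfolding q_def times_divide_times_eq power_add[symmetric] size of_nat_mult[symmetric]
      by (intro divide_right_mono of_nat_mono) auto
    then show "\<exists>N. \<forall>t\<ge>N. q (\<mu> - \<alpha>) t * q (\<nu> - \<beta>) t
        \<le> q (\<mu> \<union> \<nu> - (\<alpha> \<union> \<beta>)) t * q (\<mu> \<inter> \<nu> - \<alpha> \<inter> \<beta>) t" by blast
  qed
qed

text \<open>
  The relation is confined to positive coordinates: without that, the positions in row or column \<open>0\<close>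
  would lie below cells of a Young diagram, and the diagram would not be down-closed.
\<close>

definition row_col_less :: "nat \<times> nat \<Rightarrow> nat \<times> nat \<Rightarrow> bool" where
  "row_col_less c d \<longleftrightarrow> 1 \<le> fst c \<and> 1 \<le> snd c
     \<and> (fst c = fst d \<and> snd c < snd d \<or> snd c = snd d \<and> fst c < fst d)"

lemma partition_antimono:
  assumes "is_partition l" "1 \<le> i" "i \<le> i'"
  shows "l i' \<le> l i"
  using assms(3)
proof (induction i' rule: dec_induct)
  case (step k)
  then show ?case using assms(1,2) by (meson is_partition_def le_trans)
qed simp

lemma down_closed_young_diagram:
  assumes "young_diagram D"
  shows "down_closed row_col_less D"
proof -
  obtain l where l: "is_partition l" "D = diagram l"
    using assms by (auto simp: young_diagram_def)
  then show ?thesis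
    using partition_antimono[OF l(1)]
    by (auto simp: down_closed_def row_col_less_def diagram_def) (meson le_trans less_imp_le)
qed

text \<open>
  Tableaux are strictly increasing and linear extensions only weakly so, but for injective maps the
  two agree. An injective map into \<open>{1..card D}\<close> is automatically onto.
\<close>

lemma SYT_eq_linear_exts:
  assumes pos: "\<And>c. c \<in> D \<Longrightarrow> 1 \<le> fst c \<and> 1 \<le> snd c"
  shows "SYT D = linear_exts row_col_less D {1..card D}"
proof (intro equalityI subsetI)
  fix T assume T: "T \<in> SYT D"
  then have "bij_betw T D {1..card D}" "T \<in> extensional D" by (auto simp: SYT_def)
  then have "T \<in> D \<rightarrow>\<^sub>E {1..card D}" "inj_on T D" by (auto simp: bij_betw_def PiE_def)
  with T show "T \<in> linear_exts row_col_less D {1..card D}"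
    by (auto simp: SYT_def linear_exts_def order_maps_def row_col_less_def less_imp_le)
next
  fix T assume "T \<in> linear_exts row_col_less D {1..card D}"
  then have T: "T \<in> D \<rightarrow>\<^sub>E {1..card D}" "inj_on T D"
    and mono: "\<And>c d. c \<in> D \<Longrightarrow> d \<in> D \<Longrightarrow> row_col_less c d \<Longrightarrow> T c \<le> T d"
    by (auto simp: linear_exts_def order_maps_def)
  have strict: "T c < T d" if "c \<in> D" "d \<in> D" "row_col_less c d" for c d
  proof -
    have "c \<noteq> d" using that(3) by (auto simp: row_col_less_def)
    then show ?thesis using mono[OF that] T(2) that by (metis inj_onD le_neq_implies_less)
  qed
  have "T ` D = {1..card D}"
    using T by (intro card_subset_eq) (auto simp: card_image)
  then have "bij_betw T D {1..card D}" using T(2) by (simp add: bij_betw_def)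
  moreover have "row_col_less (i, j) (i, j')" if "(i, j) \<in> D" "j < j'" for i j j'
    using pos[OF that(1)] that(2) by (simp add: row_col_less_def)
  moreover have "row_col_less (i, j) (i', j)" if "(i, j) \<in> D" "i < i'" for i i' j
    using pos[OF that(1)] that(2) by (simp add: row_col_less_def)
  ultimately show "T \<in> SYT D" using T(1) strict by (auto simp: SYT_def PiE_def)
qed

theorem corollary3p3:
  fixes \<mu> \<alpha> \<nu> \<beta> :: "(nat \<times> nat) set"
  assumes "young_diagram \<mu>" "young_diagram \<alpha>" "\<alpha> \<subseteq> \<mu>"
    and "young_diagram \<nu>" "young_diagram \<beta>" "\<beta> \<subseteq> \<nu>"
  shows "syt_ratio ((\<mu> \<union> \<nu>) - (\<alpha> \<union> \<beta>)) * syt_ratio ((\<mu> \<inter> \<nu>) - (\<alpha> \<inter> \<beta>))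
    \<ge> syt_ratio (\<mu> - \<alpha>) * syt_ratio (\<nu> - \<beta>)"
proof -
  have pos: "1 \<le> fst c \<and> 1 \<le> snd c" if "c \<in> \<mu> \<union> \<nu>" for c
    using that assms(1,4) by (auto simp: young_diagram_def diagram_def)
  have fin: "finite \<mu>" "finite \<nu>" using assms finite_young_diagram by auto
  have ratio: "syt_ratio D = real (card (linear_exts row_col_less D {1..card D})) / fact (card D)"
    if "D \<subseteq> \<mu> \<union> \<nu>" for D
  proof -
    have "SYT D = linear_exts row_col_less D {1..card D}"
      using that pos by (intro SYT_eq_linear_exts) auto
    then show ?thesis by (simp add: syt_ratio_def)
  qed
  have "\<mu> - \<alpha> \<subseteq> \<mu> \<union> \<nu>" "\<nu> - \<beta> \<subseteq> \<mu> \<union> \<nu>" "\<mu> \<union> \<nu> - (\<alpha> \<union> \<beta>) \<subseteq> \<mu> \<union> \<nu>"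
    "\<mu> \<inter> \<nu> - \<alpha> \<inter> \<beta> \<subseteq> \<mu> \<union> \<nu>" by auto
  from this[THEN ratio] show ?thesis
    using linear_exts_join_meet[OF fin assms(1,2,4,5)[THEN down_closed_young_diagram] assms(3,6)]
    by simp
qed

end
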